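(* Let $\delta<1$ and let $\mathbb{I}_\delta$ be the partition of $[0,1]$ into intervals $I$ of length $\delta$. For each $I\in\mathbb{I}_\delta$ let $P_I$ be the Vinogradov plank of dimensions $(\delta^{-1},\delta^{-2},\delta^{-3})$ associated with $I$ and centered at the origin. Then $$\Big\|\sum_{I\in\mathbb{I}_\delta}1_{P_I}\Big\|_{L^4(\mathbb{R}^3)}^4\lesssim(\log\delta^{-1})^2\,\Big\|\sum_{I\in\mathbb{I}_\delta}1_{P_I}\Big\|_{L^1(\mathbb{R}^3)},$$ with an implicit constant independent of $\delta$.
   Context: Let $\Gamma(t)=(t,t^2,t^3)$, $t\in[0,1]$. For $I=[c,c+\delta]$, $\mathbf{t}(I),\mathbf{n}(I),\mathbf{b}(I)$ denote the unit tangent, normal and binormal vectors (Frenet frame) of $\Gamma$ at $\Gamma(c)$. The Vinogradov plank of dimensions $(\delta^{-1},\delta^{-2},\delta^{-3})$ associated with $I$ is a rectangular box with side lengths $\delta^{-1},\delta^{-2},\delta^{-3}$ in the directions $\mathbf t(I),\mathbf n(I),\mathbf b(I)$ respectively. Centered at the origin, it is, up to dilation by an $O(1)$ factor, $$\{x\in\mathbb{R}^3:\ |x_1+2cx_2+3c^2x_3|\le\delta^{-1},\ |x_2+3cx_3|\le\delta^{-2},\ |x_3|\le\delta^{-3}\}.$$ Boxes comparable up to $O(1)$ dilations are not distinguished. *)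

theory Defs
  imports "HOL-Analysis.Analysis"
begin

subsection \<open>Frenet frame of the moment curve\<close>

definition moment_curve :: "real \<Rightarrow> real^3" where
  "moment_curve t = vector [t, t^2, t^3]"

definition frenet_tangent :: "real \<Rightarrow> real^3" where
  "frenet_tangent c = sgn (vector_derivative moment_curve (at c))"

definition frenet_normal :: "real \<Rightarrow> real^3" where
  "frenet_normal c = sgn (vector_derivative frenet_tangent (at c))"

definition frenet_binormal :: "real \<Rightarrow> real^3" where
  "frenet_binormal c = cross3 (frenet_tangent c) (frenet_normal c)"


subsection \<open>Vinogradov planks\<close>

text \<open>The rectangular box centred at the origin for \<open>I = [c, c + d]\<close>, where \<open>c = Inf I\<close> and
  \<open>d = measure lborel I\<close>; its side lengths are \<open>1/d\<close>, \<open>1/d^2\<close>, \<open>1/d^3\<close>, hence the halves.\<close>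

definition frenet_box :: "real set \<Rightarrow> (real^3) set" where
  "frenet_box I = {x.
     \<bar>x \<bullet> frenet_tangent (Inf I)\<bar> \<le> (1 / measure lborel I) / 2 \<and>
     \<bar>x \<bullet> frenet_normal (Inf I)\<bar> \<le> (1 / measure lborel I)^2 / 2 \<and>
     \<bar>x \<bullet> frenet_binormal (Inf I)\<bar> \<le> (1 / measure lborel I)^3 / 2}"

text \<open>Boxes that agree up to dilation by an \<open>O(1)\<close> factor are not distinguished. So a plank
  associated with \<open>I\<close> is any box centred at the origin (not necessarily rectangular) which is
  comparable to \<open>frenet_box I\<close>, with the comparability constant \<open>C\<close> made explicit. In particular,
  for \<open>I = [c, c + d]\<close> inside \<open>[0, 1]\<close> and a suitable absolute \<open>C\<close>, this includes
  \<open>{x. \<bar>x1 + 2 c x2 + 3 c^2 x3\<bar> \<le> 1/d, \<bar>x2 + 3 c x3\<bar> \<le> 1/d^2, \<bar>x3\<bar> \<le> 1/d^3}\<close>.\<close>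

definition centred_box :: "(real^3) set \<Rightarrow> bool" where
  "centred_box P \<longleftrightarrow> (\<exists>f :: real^3 \<Rightarrow> real^3. linear f \<and> P = f ` cbox (- 1) 1)"

definition vinogradov_plank :: "real \<Rightarrow> real set \<Rightarrow> (real^3) set \<Rightarrow> bool" where
  "vinogradov_plank C I P \<longleftrightarrow>
     centred_box P \<and>
     (*\<^sub>R) (1 / C) ` frenet_box I \<subseteq> P \<and> P \<subseteq> (*\<^sub>R) C ` frenet_box I"


subsection \<open>Lebesgue norms\<close>

definition Lp_norm :: "real \<Rightarrow> ('a::euclidean_space \<Rightarrow> real) \<Rightarrow> real" where
  "Lp_norm p f = (LINT x|lborel. \<bar>f x\<bar> powr p) powr (1 / p)"

text \<open>The Bochner integral of a non-integrable function is \<open>0\<close>. This never happens for the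
  functions to which \<open>Lp_norm\<close> is applied here.\<close>

lemma integrable_sum_indicator_planks:
  assumes "finite II" and "\<And>I. I \<in> II \<Longrightarrow> vinogradov_plank C I (P I)" and p: "(p::real) > 0"
  shows "integrable lborel (\<lambda>x. \<bar>\<Sum>I\<in>II. indicator (P I) x\<bar> powr p)"
proof -
  have comp: "compact (P I)" if "I \<in> II" for I
    using assms(2)[OF that]
    by (auto simp: vinogradov_plank_def centred_box_def
        intro!: compact_continuous_image linear_continuous_on linear_conv_bounded_linear[THEN iffD1])
  let ?U = "\<Union>I\<in>II. P I"
  have U: "compact ?U" using assms(1) comp by (intro compact_UN) auto
  have [measurable]: "P I \<in> sets borel" if "I \<in> II" for I
    using comp[OF that] by (simp add: borel_compact)
  have meas: "(\<lambda>x. \<bar>\<Sum>I\<in>II. indicator (P I) x :: real\<bar> powr p) \<in> borel_measurable lborel"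
    by measurable
  have dom: "integrable lborel (\<lambda>x. real (card II) powr p * indicator ?U x)"
    using borel_integrable_compact[OF U, of "\<lambda>_. real (card II) powr p"]
    by (simp add: indicator_scaleR_eq_if mult.commute)
  show ?thesis
  proof (rule Bochner_Integration.integrable_bound[OF dom meas], rule AE_I2)
    fix x
    show "norm (\<bar>\<Sum>I\<in>II. indicator (P I) x :: real\<bar> powr p)
        \<le> norm (real (card II) powr p * indicator ?U x :: real)"
    proof (cases "x \<in> ?U")
      case True
      have "(\<Sum>I\<in>II. indicator (P I) x :: real) \<le> (\<Sum>I\<in>II. 1)"
        by (intro sum_mono) (auto simp: indicator_def)
      moreover have "(\<Sum>I\<in>II. indicator (P I) x :: real) \<ge> 0"
        by (intro sum_nonneg) auto
      ultimately have "\<bar>\<Sum>I\<in>II. indicator (P I) x :: real\<bar> \<le> real (card II)"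
        by simp
      then show ?thesis using p True
        by (simp only: indicator_simps) (simp add: powr_mono2)
    next
      case False
      then have "(\<Sum>I\<in>II. indicator (P I) x :: real) = 0"
        by (intro sum.neutral) auto
      then show ?thesis by simp
    qed
  qed
qed

end

theory Submission
  imports Defs
begin

text \<open>Let \<open>f\<close> count the planks through a point, and give the plank of \<open>I\<close> the integer
  \<open>\<kappa> I = \<lfloor>Inf I / \<delta>\<rfloor>\<close>. A set of \<open>n\<close> integers satisfies \<open>n^3 \<le> 3 * (\<Sum>i j. \<bar>i - j\<bar> + 1)\<close>, so
  the integral of \<open>f^4\<close> is at most three times the sum over triples of
  \<open>(\<bar>i - j\<bar> + 1) * vol (P\<^sub>i \<inter> P\<^sub>j \<inter> P\<^sub>k)\<close>. On a plank the
  linear form \<open>x1 + 2 c x2 + 3 c^2 x3\<close> is bounded by a multiple of \<open>1 / \<delta>\<close>, and the determinant of three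
  such forms is a Vandermonde determinant in \<open>c\<close>; hence the triple intersection has volume at most a
  multiple of \<open>\<delta>^-6 / (\<bar>i - j\<bar> \<bar>j - k\<bar> \<bar>i - k\<bar>)\<close>. The factor \<open>\<bar>i - j\<bar>\<close> cancels, and the remaining sum over
  \<open>i\<close> and \<open>j\<close> is for each \<open>k\<close> the square of a harmonic sum.\<close>

subsection \<open>Separated integers\<close>

text \<open>The truncation at 1 gives the diagonal weight 1, so a product of three weights also
  makes sense for triples with repetitions.\<close>

definition sep_weight :: "nat \<Rightarrow> nat \<Rightarrow> real" where
  "sep_weight m n = 1 / max 1 \<bar>real m - real n\<bar>"

lemma sep_weight_nonneg [simp]: "0 \<le> sep_weight m n"
  by (simp add: sep_weight_def)

lemma sep_weight_commute: "sep_weight m n = sep_weight n m"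
  by (simp add: sep_weight_def abs_minus_commute)

lemma sep_weight_self [simp]: "sep_weight n n = 1"
  by (simp add: sep_weight_def)

lemma sep_weight_distinct: "m \<noteq> n \<Longrightarrow> sep_weight m n = 1 / \<bar>real m - real n\<bar>"
  by (auto simp: sep_weight_def max_def)

text \<open>This is the cancellation of the factor coming from the combinatorial bound: the product
  is 1 on the diagonal and \<open>1 + 1 / d\<close> at distance \<open>d \<ge> 1\<close>.\<close>

lemma dist_times_sep_weight_le: "(\<bar>real m - real n\<bar> + 1) * sep_weight m n \<le> 2"
  by (cases "m = n") (auto simp: sep_weight_distinct field_simps nat_neq_iff)

text \<open>The integers below \<open>n\<close> and those above \<open>n\<close> each contribute a
  harmonic sum, and \<open>n\<close> itself contributes 1.\<close>

lemma sum_sep_weight_le: "(\<Sum>m\<le>N. sep_weight m n) \<le> 1 + 2 * harm N" if "n \<le> N"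
proof -
  have lt: "(\<Sum>m<n. sep_weight m n) = harm n"
  proof -
    have "(\<Sum>m<n. sep_weight m n) = (\<Sum>m<n. inverse (of_nat (Suc (n - Suc m))))"
      by (intro sum.cong) (auto simp: sep_weight_def max_def of_nat_diff field_simps)
    also have "\<dots> = harm n"
      by (subst sum.nat_diff_reindex[where g = "\<lambda>m. inverse (of_nat (Suc m))"])
        (simp add: harm_altdef)
    finally show ?thesis .
  qed
  have gt: "(\<Sum>m\<in>{n<..N}. sep_weight m n) = harm (N - n)"
  proof -
    have "(\<Sum>m\<in>{n<..N}. sep_weight m n) = (\<Sum>k\<in>{..<N - n}. inverse (of_nat (Suc k)))"
      by (rule sum.reindex_bij_witness[where i = "\<lambda>k. Suc (n + k)" and j = "\<lambda>m. m - Suc n"])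
        (auto simp: sep_weight_def max_def of_nat_diff field_simps)
    then show ?thesis by (simp add: harm_altdef)
  qed
  have "{..N} = {..<n} \<union> ({n} \<union> {n<..N})"
    using that by auto
  then have "(\<Sum>m\<le>N. sep_weight m n)
      = (\<Sum>m<n. sep_weight m n) + (1 + (\<Sum>m\<in>{n<..N}. sep_weight m n))"
    by (subst \<open>{..N} = _\<close>, subst sum.union_disjoint) auto
  also have "\<dots> \<le> 1 + 2 * harm N"
    using harm_mono[of n N, where 'a = real] harm_mono[of "N - n" N, where 'a = real] that
    by (simp add: lt gt)
  finally show ?thesis .
qed

text \<open>The sequence \<open>harm N - ln N\<close> decreases from its value 1 at
  \<open>N = 1\<close>.\<close>

lemma harm_le_ln: "harm N \<le> 1 + ln (real N)" if "N > 0"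
  using euler_mascheroni_sequence_decreasing[of 1 N] that by (simp add: harm_def)

text \<open>Among any three numbers one lies between the other two, so at least a third of all triples
  have their last entry between the first two.\<close>

lemma card_cube_le_sum_dist_nat:
  fixes S :: "nat set"
  assumes "finite S"
  shows "real (card S) ^ 3 \<le> 3 * (\<Sum>i\<in>S. \<Sum>j\<in>S. \<bar>real i - real j\<bar> + 1)"
proof -
  define B :: "nat \<Rightarrow> nat \<Rightarrow> nat \<Rightarrow> real" where
    "B i j k = of_bool (k \<in> {min i j..max i j})" for i j k
  have B3: "1 \<le> B i j k + B j k i + B k i j" for i j k
    by (auto simp: B_def min_def max_def)
  have "real (card S) ^ 3 = (\<Sum>i\<in>S. \<Sum>j\<in>S. \<Sum>k\<in>S. 1)"
    by (simp add: power3_eq_cube)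
  also have "\<dots> \<le> (\<Sum>i\<in>S. \<Sum>j\<in>S. \<Sum>k\<in>S. B i j k + B j k i + B k i j)"
    by (intro sum_mono B3)
  also have "\<dots> = (\<Sum>i\<in>S. \<Sum>j\<in>S. \<Sum>k\<in>S. B i j k) + (\<Sum>i\<in>S. \<Sum>j\<in>S. \<Sum>k\<in>S. B j k i)
      + (\<Sum>i\<in>S. \<Sum>j\<in>S. \<Sum>k\<in>S. B k i j)"
    by (simp add: sum.distrib)
  \<comment> \<open>All three indices run over the same set, so a cyclic shift of the arguments of
    \<open>B\<close> only renames them.\<close>
  also have "(\<Sum>i\<in>S. \<Sum>j\<in>S. \<Sum>k\<in>S. B j k i) = (\<Sum>i\<in>S. \<Sum>j\<in>S. \<Sum>k\<in>S. B i j k)"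
    by (subst sum.swap, rule sum.cong[OF refl], rule sum.swap)
  also have "(\<Sum>i\<in>S. \<Sum>j\<in>S. \<Sum>k\<in>S. B k i j) = (\<Sum>i\<in>S. \<Sum>j\<in>S. \<Sum>k\<in>S. B i j k)"
    by (subst sum.swap[of _ S S], subst sum.swap) (rule refl)
  also have "(\<Sum>i\<in>S. \<Sum>j\<in>S. \<Sum>k\<in>S. B i j k) \<le> (\<Sum>i\<in>S. \<Sum>j\<in>S. \<bar>real i - real j\<bar> + 1)"
  proof (intro sum_mono)
    fix i j
    have "(\<Sum>k\<in>S. B i j k) = real (card (S \<inter> {min i j..max i j}))"
      using assms by (simp add: B_def of_bool_def sum.If_cases Int_def)
    also have "\<dots> \<le> real (card {min i j..max i j})"
      by (intro of_nat_mono card_mono) auto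
    also have "\<dots> = \<bar>real i - real j\<bar> + 1"
      by (auto simp: min_def max_def)
    finally show "(\<Sum>k\<in>S. B i j k) \<le> \<bar>real i - real j\<bar> + 1" .
  qed
  finally show ?thesis by simp
qed

text \<open>The fourth factor \<open>card S\<close> becomes a sum over an index \<open>k\<close> on
  which the summand does not depend. This third index later produces triple intersections.\<close>

lemma card_power4_le_sum_dist:
  fixes f :: "'a \<Rightarrow> nat"
  assumes "finite S" "inj_on f S"
  shows "real (card S) ^ 4
      \<le> 3 * (\<Sum>i\<in>S. \<Sum>j\<in>S. \<Sum>k\<in>S. \<bar>real (f i) - real (f j)\<bar> + 1)"
proof -
  have "real (card S) ^ 3 \<le> 3 * (\<Sum>i\<in>S. \<Sum>j\<in>S. \<bar>real (f i) - real (f j)\<bar> + 1)"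
    using card_cube_le_sum_dist_nat[of "f ` S"] assms
    by (simp add: card_image sum.reindex)
  from mult_left_mono[OF this, of "real (card S)"] show ?thesis
    by (simp add: eval_nat_numeral sum_distrib_left mult_ac)
qed

subsection \<open>Volumes\<close>

lemma content_symmetric_cbox_3:
  assumes "0 \<le> p" "0 \<le> q" "0 \<le> r"
  shows "measure lborel (cbox (- vector [p, q, r]) (vector [p, q, r] :: real^3)) = 8 * p * q * r"
proof -
  have ne: "cbox (- vector [p, q, r]) (vector [p, q, r] :: real^3) \<noteq> {}"
    using assms by (simp add: interval_ne_empty_cart forall_3)
  have prod: "(\<Prod>i\<in>UNIV. f i) = f 1 * f 2 * f 3" for f :: "3 \<Rightarrow> real"
    unfolding UNIV_3 by (simp add: mult.assoc)
  show ?thesis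
    unfolding content_cbox_cart[OF ne] prod by simp
qed

lemma vector_3_mult_vector_nth:
  fixes u v w x :: "real^3"
  shows "((vector [u, v, w] :: real^3^3) *v x) $ 1 = x \<bullet> u"
    and "((vector [u, v, w] :: real^3^3) *v x) $ 2 = x \<bullet> v"
    and "((vector [u, v, w] :: real^3^3) *v x) $ 3 = x \<bullet> w"
  by (simp_all only: matrix_vector_mul_component vector_3 inner_commute[of x])

text \<open>The linear map with rows \<open>u\<close>, \<open>v\<close>, \<open>w\<close> scales
  volume by the absolute determinant and sends \<open>S\<close> into a box with half sides
  \<open>p\<close>, \<open>q\<close>, \<open>r\<close>. The product form also covers a vanishing
  determinant.\<close>

lemma det_times_measure_le:
  fixes S :: "(real^3) set" and u v w :: "real^3"
  assumes S: "compact S"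
    and bnd: "\<And>x. x \<in> S \<Longrightarrow> \<bar>x \<bullet> u\<bar> \<le> p \<and> \<bar>x \<bullet> v\<bar> \<le> q \<and> \<bar>x \<bullet> w\<bar> \<le> r"
    and "0 \<le> p" "0 \<le> q" "0 \<le> r"
  shows "\<bar>det (vector [u, v, w] :: real^3^3)\<bar> * measure lborel S \<le> 8 * p * q * r"
proof -
  let ?A = "vector [u, v, w] :: real^3^3"
  let ?b = "vector [p, q, r] :: real^3"
  have meas: "measure lebesgue S = measure lborel S"
    using S by (simp add: borel_compact)
  have lm: "S \<in> lmeasurable"
    using S by (rule lmeasurable_compact)
  have lin: "linear ((*v) ?A)" by simp
  note row = vector_3_mult_vector_nth[of u v w]
  have sub: "(*v) ?A ` S \<subseteq> cbox (- ?b) ?b"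
  proof (rule image_subsetI)
    fix x assume "x \<in> S"
    from bnd[OF this] show "?A *v x \<in> cbox (- ?b) ?b"
      by (simp add: mem_box_cart forall_3 row abs_le_iff)
  qed
  have "measure lborel (cbox (- ?b) ?b) = 8 * p * q * r"
    using assms(3-5) by (rule content_symmetric_cbox_3)
  then have box: "measure lebesgue (cbox (- ?b) ?b) = 8 * p * q * r"
    by simp
  have "\<bar>det ?A\<bar> * measure lborel S = measure lebesgue ((*v) ?A ` S)"
    unfolding measure_linear_image[OF lin lm] matrix_of_matrix_vector_mul meas ..
  also have "\<dots> \<le> measure lebesgue (cbox (- ?b) ?b)"
    by (rule measure_mono_fmeasurable[OF sub fmeasurableD[OF measurable_linear_image[OF lin lm]]
          lmeasurable_cbox])
  finally show ?thesis
    unfolding box .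
qed

section \<open>Boxes in an orthonormal frame\<close>

lemma orthogonal_matrix_vector_3:
  fixes u v w :: "real^3"
  assumes "norm u = 1" "norm v = 1" "norm w = 1" "u \<bullet> v = 0" "u \<bullet> w = 0" "v \<bullet> w = 0"
  shows "orthogonal_matrix (vector [u, v, w] :: real^3^3)"
proof -
  let ?A = "vector [u, v, w] :: real^3^3"
  have rows: "row 1 ?A = u" "row 2 ?A = v" "row 3 ?A = w"
    by (simp_all add: row_def)
  show ?thesis
    unfolding orthogonal_matrix_orthonormal_rows
  proof (intro conjI allI impI)
    fix i :: 3
    show "norm (row i ?A) = 1"
      using exhaust_3[of i] rows assms by metis
  next
    fix i j :: 3
    assume "i \<noteq> j"
    then show "orthogonal (row i ?A) (row j ?A)"
      unfolding orthogonal_def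
      using exhaust_3[of i] exhaust_3[of j] rows assms inner_commute by metis
  qed
qed

lemma norm_le_orthonormal_sum:
  fixes u v w x :: "real^3"
  assumes "norm u = 1" "norm v = 1" "norm w = 1" "u \<bullet> v = 0" "u \<bullet> w = 0" "v \<bullet> w = 0"
  shows "norm x \<le> \<bar>x \<bullet> u\<bar> + \<bar>x \<bullet> v\<bar> + \<bar>x \<bullet> w\<bar>"
proof -
  let ?A = "vector [u, v, w] :: real^3^3"
  have "orthogonal_transformation ((*v) ?A)"
    using orthogonal_matrix_vector_3[OF assms] by (simp add: orthogonal_transformation_matrix)
  then have "norm x = norm (?A *v x)"
    by (simp add: orthogonal_transformation_norm)
  also have "\<dots> \<le> \<bar>x \<bullet> u\<bar> + \<bar>x \<bullet> v\<bar> + \<bar>x \<bullet> w\<bar>"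
    using norm_le_l1_cart[of "?A *v x"] by (simp add: sum_3 vector_3_mult_vector_nth)
  finally show ?thesis .
qed

text \<open>The transpose of the frame matrix is its inverse, so the set is an isometric image of a
  coordinate box.\<close>

lemma measure_orthonormal_box:
  fixes u v w :: "real^3"
  assumes "norm u = 1" "norm v = 1" "norm w = 1" "u \<bullet> v = 0" "u \<bullet> w = 0" "v \<bullet> w = 0"
    and "0 \<le> p" "0 \<le> q" "0 \<le> r"
  shows "measure lebesgue {x. \<bar>x \<bullet> u\<bar> \<le> p \<and> \<bar>x \<bullet> v\<bar> \<le> q \<and> \<bar>x \<bullet> w\<bar> \<le> r} = 8 * p * q * r"
    and "compact {x. \<bar>x \<bullet> u\<bar> \<le> p \<and> \<bar>x \<bullet> v\<bar> \<le> q \<and> \<bar>x \<bullet> w\<bar> \<le> r}"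
proof -
  let ?A = "vector [u, v, w] :: real^3^3"
  let ?b = "vector [p, q, r] :: real^3"
  let ?S = "{x. \<bar>x \<bullet> u\<bar> \<le> p \<and> \<bar>x \<bullet> v\<bar> \<le> q \<and> \<bar>x \<bullet> w\<bar> \<le> r}"
  note row = vector_3_mult_vector_nth[of u v w]
  have "orthogonal_matrix ?A"
    using assms(1-6) by (rule orthogonal_matrix_vector_3)
  then have inv: "?A ** transpose ?A = mat 1" "transpose ?A ** ?A = mat 1"
    by (auto simp: orthogonal_matrix_def)
  have det: "\<bar>det (transpose ?A)\<bar> = 1"
    using det_orthogonal_matrix[OF \<open>orthogonal_matrix ?A\<close>] by auto
  have lin: "linear ((*v) (transpose ?A))" by simp
  have eq: "?S = (*v) (transpose ?A) ` cbox (- ?b) ?b"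
  proof (intro set_eqI iffI)
    fix x assume "x \<in> ?S"
    then have "?A *v x \<in> cbox (- ?b) ?b"
      by (simp add: mem_box_cart forall_3 abs_le_iff row)
    moreover have "x = transpose ?A *v (?A *v x)"
      by (simp only: matrix_vector_mul_assoc inv matrix_vector_mul_lid)
    ultimately show "x \<in> (*v) (transpose ?A) ` cbox (- ?b) ?b" by blast
  next
    fix x assume "x \<in> (*v) (transpose ?A) ` cbox (- ?b) ?b"
    then obtain y where y: "y \<in> cbox (- ?b) ?b" "x = transpose ?A *v y" by blast
    then have "?A *v x = y"
      by (simp only: matrix_vector_mul_assoc inv matrix_vector_mul_lid)
    with y(1) show "x \<in> ?S"
      by (simp add: mem_box_cart forall_3 abs_le_iff flip: row)
  qed
  have "measure lborel (cbox (- ?b) ?b) = 8 * p * q * r"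
    using assms(7-9) by (rule content_symmetric_cbox_3)
  then have box: "measure lebesgue (cbox (- ?b) ?b) = 8 * p * q * r"
    by simp
  show "measure lebesgue ?S = 8 * p * q * r"
    unfolding eq measure_linear_image[OF lin lmeasurable_cbox] matrix_of_matrix_vector_mul det box
    by simp
  show "compact ?S"
    unfolding eq
    by (intro compact_continuous_image compact_cbox matrix_vector_mult_linear_continuous_on)
qed

subsection \<open>The Frenet frame of the moment curve\<close>

lemma has_vector_derivative_vector_3:
  fixes f g h :: "real \<Rightarrow> real"
  assumes "(f has_real_derivative f') (at t)" "(g has_real_derivative g') (at t)"
    "(h has_real_derivative h') (at t)"
  shows "((\<lambda>t. vector [f t, g t, h t] :: real^3) has_vector_derivative vector [f', g', h']) (at t)"
proof -
  have eq: "vector [a, b, c] = a *\<^sub>R axis 1 1 + b *\<^sub>R axis 2 1 + c *\<^sub>R (axis 3 1 :: real^3)"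
    for a b c :: real
    by (simp add: vec_eq_iff forall_3 axis_def)
  show ?thesis
    unfolding eq using assms
    by (auto intro!: derivative_eq_intros simp: has_real_derivative_iff_has_vector_derivative)
qed

text \<open>Pairing \<open>x\<close> with this vector and with
  \<open>curve_half_acceleration c\<close> gives \<open>x1 + 2 c x2 + 3 c^2 x3\<close> and
  \<open>x2 + 3 c x3\<close>, the first two linear forms that describe a plank.\<close>

definition curve_velocity :: "real \<Rightarrow> real^3" where
  "curve_velocity c = vector [1, 2 * c, 3 * c\<^sup>2]"

definition curve_half_acceleration :: "real \<Rightarrow> real^3" where
  "curve_half_acceleration c = vector [0, 1, 3 * c]"

text \<open>Up to a positive scalar this is the derivative of the unit tangent.\<close>

definition curve_normal :: "real \<Rightarrow> real^3" where
  "curve_normal c = vector [- 2 * c - 9 * c ^ 3, 1 - 9 * c ^ 4, 3 * c + 6 * c ^ 3]"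

definition curve_speed_sq :: "real \<Rightarrow> real" where
  "curve_speed_sq c = 1 + 4 * c\<^sup>2 + 9 * c ^ 4"

lemma curve_speed_sq_ge_1: "1 \<le> curve_speed_sq c"
  by (simp add: curve_speed_sq_def)

lemma norm_curve_velocity: "norm (curve_velocity c) = sqrt (curve_speed_sq c)"
  by (simp add: norm_eq_sqrt_inner inner_vec_def sum_3 curve_velocity_def curve_speed_sq_def
      power2_eq_square eval_nat_numeral algebra_simps)

lemma frenet_tangent_eq: "frenet_tangent c = sgn (curve_velocity c)"
proof -
  have "(moment_curve has_vector_derivative curve_velocity c) (at c)"
    unfolding moment_curve_def[abs_def] curve_velocity_def
    by (rule has_vector_derivative_vector_3) (auto intro!: derivative_eq_intros)
  then show ?thesis
    by (simp add: frenet_tangent_def vector_derivative_at)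
qed

text \<open>The quotient rule for one component of the unit tangent;
  \<open>4 * c + 18 * c ^ 3\<close> is half the derivative of \<open>curve_speed_sq\<close>.\<close>

lemma DERIV_divide_sqrt_speed_sq:
  assumes "(g has_real_derivative g') (at c)"
  shows "((\<lambda>c. g c / sqrt (curve_speed_sq c)) has_real_derivative
      (g' * curve_speed_sq c - g c * (4 * c + 18 * c ^ 3))
        / (curve_speed_sq c * sqrt (curve_speed_sq c))) (at c)"
proof -
  have pos: "curve_speed_sq c > 0"
    using curve_speed_sq_ge_1[of c] by simp
  have "(curve_speed_sq has_real_derivative 8 * c + 36 * c ^ 3) (at c)"
    unfolding curve_speed_sq_def[abs_def] by (auto intro!: derivative_eq_intros)
  from DERIV_chain2[OF DERIV_real_sqrt[OF pos] this]
  have "((\<lambda>c. sqrt (curve_speed_sq c)) has_real_derivative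
      inverse (sqrt (curve_speed_sq c)) / 2 * (8 * c + 36 * c ^ 3)) (at c)" .
  from DERIV_divide[OF assms this] pos show ?thesis
    by (auto simp: field_simps elim!: DERIV_cong)
qed

lemma frenet_normal_eq: "frenet_normal c = sgn (curve_normal c)"
proof -
  \<comment> \<open>Over the common denominator, the numerators of the derivative of the tangent are
    twice the components of \<open>curve_normal c\<close>. The positive factor \<open>k\<close> then
    disappears under \<open>sgn\<close>.\<close>
  define k where "k = 2 / (curve_speed_sq c * sqrt (curve_speed_sq c))"
  have pos: "curve_speed_sq c > 0"
    using curve_speed_sq_ge_1[of c] by simp
  have tan: "frenet_tangent = (\<lambda>c. vector [1 / sqrt (curve_speed_sq c),
      2 * c / sqrt (curve_speed_sq c), 3 * c\<^sup>2 / sqrt (curve_speed_sq c)])"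
    by (rule ext) (simp add: frenet_tangent_eq sgn_div_norm norm_curve_velocity vec_eq_iff forall_3,
        simp add: curve_velocity_def field_simps)
  have "(frenet_tangent has_vector_derivative k *\<^sub>R curve_normal c) (at c)"
    unfolding tan
  proof (rule has_vector_derivative_eq_rhs[OF has_vector_derivative_vector_3])
    show "((\<lambda>c. 1 / sqrt (curve_speed_sq c)) has_real_derivative
      (0 * curve_speed_sq c - 1 * (4 * c + 18 * c ^ 3))
        / (curve_speed_sq c * sqrt (curve_speed_sq c))) (at c)"
      by (rule DERIV_divide_sqrt_speed_sq) simp
    show "((\<lambda>c. 2 * c / sqrt (curve_speed_sq c)) has_real_derivative
      (2 * curve_speed_sq c - 2 * c * (4 * c + 18 * c ^ 3))
        / (curve_speed_sq c * sqrt (curve_speed_sq c))) (at c)"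
      by (rule DERIV_divide_sqrt_speed_sq) (auto intro!: derivative_eq_intros)
    show "((\<lambda>c. 3 * c\<^sup>2 / sqrt (curve_speed_sq c)) has_real_derivative
      (6 * c * curve_speed_sq c - 3 * c\<^sup>2 * (4 * c + 18 * c ^ 3))
        / (curve_speed_sq c * sqrt (curve_speed_sq c))) (at c)"
      by (rule DERIV_divide_sqrt_speed_sq) (auto intro!: derivative_eq_intros)
    have num: "- (4 * c + 18 * c ^ 3) = 2 * (- 2 * c - 9 * c ^ 3)"
      "2 * curve_speed_sq c - 2 * c * (4 * c + 18 * c ^ 3) = 2 * (1 - 9 * c ^ 4)"
      "6 * c * curve_speed_sq c - 3 * c\<^sup>2 * (4 * c + 18 * c ^ 3) = 2 * (3 * c + 6 * c ^ 3)"
      by (simp_all add: curve_speed_sq_def eval_nat_numeral algebra_simps)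
    show "vector [(0 * curve_speed_sq c - 1 * (4 * c + 18 * c ^ 3))
          / (curve_speed_sq c * sqrt (curve_speed_sq c)),
        (2 * curve_speed_sq c - 2 * c * (4 * c + 18 * c ^ 3))
          / (curve_speed_sq c * sqrt (curve_speed_sq c)),
        (6 * c * curve_speed_sq c - 3 * c\<^sup>2 * (4 * c + 18 * c ^ 3))
          / (curve_speed_sq c * sqrt (curve_speed_sq c))] = k *\<^sub>R curve_normal c"
      unfolding vec_eq_iff forall_3
      by (simp only: num mult_zero_left mult_1 diff_0 vector_3 curve_normal_def k_def
          vector_scaleR_component real_scaleR_def times_divide_eq_left)
  qed
  then have "frenet_normal c = sgn (k *\<^sub>R curve_normal c)"
    by (simp add: frenet_normal_def vector_derivative_at)
  moreover have "k > 0"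
    using pos by (simp add: k_def)
  ultimately show ?thesis
    by (simp add: sgn_scaleR)
qed

lemma curve_velocity_orthogonal_normal: "curve_velocity c \<bullet> curve_normal c = 0"
  by (simp add: inner_vec_def sum_3 curve_velocity_def curve_normal_def eval_nat_numeral algebra_simps)

text \<open>Gram-Schmidt without division: \<open>2 * c + 9 * c ^ 3\<close> is the inner product of
  half acceleration and velocity, and \<open>curve_speed_sq c\<close> is the squared norm of the
  velocity.\<close>

lemma half_acceleration_decomposition:
  "curve_speed_sq c *\<^sub>R curve_half_acceleration c
    = curve_normal c + (2 * c + 9 * c ^ 3) *\<^sub>R curve_velocity c"
  by (simp add: vec_eq_iff forall_3 curve_velocity_def curve_normal_def curve_half_acceleration_def
      curve_speed_sq_def eval_nat_numeral algebra_simps)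

lemma curve_velocity_nonzero: "curve_velocity c \<noteq> 0"
  by (metis curve_velocity_def vector_3(1) zero_index zero_neq_one)

text \<open>The third component vanishes only at \<open>c = 0\<close>, where the second one is
  1.\<close>

lemma curve_normal_nonzero: "curve_normal c \<noteq> 0"
proof
  assume 0: "curve_normal c = 0"
  then have "curve_normal c $ 3 = 0" "curve_normal c $ 2 = 0" by simp_all
  then have "3 * c * (1 + 2 * c\<^sup>2) = 0" "1 - 9 * c ^ 4 = 0"
    by (simp_all add: curve_normal_def eval_nat_numeral algebra_simps)
  moreover have "1 + 2 * c\<^sup>2 > 0"
    by (simp add: add_pos_nonneg)
  ultimately show False by auto
qed

lemma frenet_frame_orthonormal:
  shows "norm (frenet_tangent c) = 1" "norm (frenet_normal c) = 1" "norm (frenet_binormal c) = 1"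
    "frenet_tangent c \<bullet> frenet_normal c = 0" "frenet_tangent c \<bullet> frenet_binormal c = 0"
    "frenet_normal c \<bullet> frenet_binormal c = 0"
proof -
  show t: "norm (frenet_tangent c) = 1"
    by (simp add: frenet_tangent_eq norm_sgn curve_velocity_nonzero)
  show n: "norm (frenet_normal c) = 1"
    by (simp add: frenet_normal_eq norm_sgn curve_normal_nonzero)
  show tn: "frenet_tangent c \<bullet> frenet_normal c = 0"
    by (simp add: frenet_tangent_eq frenet_normal_eq sgn_div_norm curve_velocity_orthogonal_normal)
  have "(norm (frenet_binormal c))\<^sup>2 = 1"
    using norm_cross[of "frenet_tangent c" "frenet_normal c"]
    by (simp add: frenet_binormal_def t n tn)
  then show "norm (frenet_binormal c) = 1"
    by (simp add: power2_eq_1_iff) (smt (verit) norm_ge_zero)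
  show "frenet_tangent c \<bullet> frenet_binormal c = 0" "frenet_normal c \<bullet> frenet_binormal c = 0"
    by (simp_all add: frenet_binormal_def dot_cross_self)
qed

text \<open>The squared speed is at most \<open>1 + 4 + 9\<close>, and the components of the normal
  are at most 11, 8 and 9 in absolute value.\<close>

lemma moment_curve_bounds:
  assumes "0 \<le> c" "c \<le> 1"
  shows "norm (curve_velocity c) \<le> 4" "norm (curve_normal c) \<le> 28" "2 * c + 9 * c ^ 3 \<le> 11"
proof -
  have pw: "0 \<le> c ^ n" "c ^ n \<le> 1" for n
    using assms by (auto intro: power_le_one)
  have "curve_speed_sq c \<le> 4\<^sup>2"
    using pw(2)[of 2] pw(2)[of 4] by (simp add: curve_speed_sq_def)
  then show "norm (curve_velocity c) \<le> 4"
    unfolding norm_curve_velocity by (intro real_le_lsqrt) auto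
  have "norm (curve_normal c) \<le> \<bar>- 2 * c - 9 * c ^ 3\<bar> + \<bar>1 - 9 * c ^ 4\<bar> + \<bar>3 * c + 6 * c ^ 3\<bar>"
    using norm_le_l1_cart[of "curve_normal c"] by (simp add: sum_3 curve_normal_def)
  also have "\<dots> \<le> 28"
    using pw(1)[of 3] pw(2)[of 3] pw(1)[of 4] pw(2)[of 4] assms by linarith
  finally show "norm (curve_normal c) \<le> 28" .
  show "2 * c + 9 * c ^ 3 \<le> 11"
    using pw(2)[of 3] assms by linarith
qed

lemma inner_eq_norm_times_inner_sgn: "x \<bullet> v = norm v * (x \<bullet> sgn v)"
  for x v :: "'a::real_inner"
  by (cases "v = 0") (simp_all add: sgn_div_norm)

subsection \<open>Intersections of planks\<close>

text \<open>Taking the factors 1, 2, 3 out of the columns leaves a Vandermonde matrix.\<close>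

lemma det_velocity_velocity_velocity:
  "det (vector [curve_velocity a, curve_velocity b, curve_velocity c] :: real^3^3)
    = 6 * (b - a) * (c - b) * (c - a)"
  by (simp add: det_3 curve_velocity_def power2_eq_square algebra_simps)

lemma det_velocity_acceleration_velocity:
  "det (vector [curve_velocity a, curve_half_acceleration a, curve_velocity b] :: real^3^3)
    = 3 * (b - a)\<^sup>2"
  by (simp add: det_3 curve_velocity_def curve_half_acceleration_def power2_eq_square algebra_simps)

lemma det_velocity_acceleration_axis:
  "det (vector [curve_velocity a, curve_half_acceleration a, axis 3 1] :: real^3^3) = 1"
  by (simp add: det_3 curve_velocity_def curve_half_acceleration_def axis_def)

text \<open>The last two determinants are the confluent forms of the first one; they replace it for
  triples of planks with repetitions.\<close>

definition standard_plank :: "real \<Rightarrow> real \<Rightarrow> real \<Rightarrow> (real^3) set" where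
  "standard_plank K \<delta> c = {x. \<bar>x \<bullet> curve_velocity c\<bar> \<le> K / \<delta> \<and>
     \<bar>x \<bullet> curve_half_acceleration c\<bar> \<le> K / \<delta>\<^sup>2 \<and> \<bar>x \<bullet> axis 3 1\<bar> \<le> K / \<delta> ^ 3}"

lemma measure_one_plank_le:
  assumes "compact S" "S \<subseteq> standard_plank K \<delta> a" "0 \<le> K" "0 < \<delta>"
  shows "measure lborel S \<le> 8 * K ^ 3 / \<delta> ^ 6"
proof -
  have "\<bar>det (vector [curve_velocity a, curve_half_acceleration a, axis 3 1] :: real^3^3)\<bar>
      * measure lborel S \<le> 8 * (K / \<delta>) * (K / \<delta>\<^sup>2) * (K / \<delta> ^ 3)"
    by (rule det_times_measure_le) (use assms in \<open>auto simp: standard_plank_def\<close>)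
  then show ?thesis
    by (simp add: det_velocity_acceleration_axis eval_nat_numeral mult_ac)
qed

text \<open>Two forms come from the plank at \<open>a\<close> and one from that at \<open>b\<close>,
  which bounds the image box by a multiple of \<open>\<delta>^-4\<close>; the determinant is at
  least \<open>3 / 4 * (\<delta> * d)^2\<close> and supplies the rest. The quotient
  \<open>8 / (3 / 4) = 32 / 3\<close> is rounded up to 11.\<close>

lemma measure_two_planks_le:
  assumes "compact S" "S \<subseteq> standard_plank K \<delta> a" "S \<subseteq> standard_plank K \<delta> b"
    and "0 \<le> K" "0 < \<delta>" "0 < d" "\<delta> * d \<le> 2 * \<bar>a - b\<bar>"
  shows "measure lborel S \<le> 11 * K ^ 3 / \<delta> ^ 6 * (1 / d)\<^sup>2"
proof -
  have "(\<delta> * d)\<^sup>2 \<le> (2 * \<bar>a - b\<bar>)\<^sup>2"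
    using assms by (intro power_mono) auto
  then have "3 / 4 * (\<delta> * d)\<^sup>2 \<le> \<bar>3 * (b - a)\<^sup>2\<bar>"
    by (simp add: power_mult_distrib power2_commute)
  then have "3 / 4 * (\<delta> * d)\<^sup>2 * measure lborel S \<le> \<bar>3 * (b - a)\<^sup>2\<bar> * measure lborel S"
    by (intro mult_right_mono) auto
  also have "\<dots> = \<bar>det (vector [curve_velocity a, curve_half_acceleration a, curve_velocity b] :: real^3^3)\<bar>
      * measure lborel S"
    by (simp only: det_velocity_acceleration_velocity)
  also have "\<dots> \<le> 8 * (K / \<delta>) * (K / \<delta>\<^sup>2) * (K / \<delta>)"
    by (rule det_times_measure_le) (use assms in \<open>auto simp: standard_plank_def\<close>)
  finally have "measure lborel S \<le> 8 * (K / \<delta>) * (K / \<delta>\<^sup>2) * (K / \<delta>) / (3 / 4 * (\<delta> * d)\<^sup>2)"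
    using assms by (subst pos_le_divide_eq) (auto simp: mult_ac)
  also have "\<dots> = 32 / 3 * (K ^ 3 / \<delta> ^ 6 * (1 / d)\<^sup>2)"
    by (simp add: eval_nat_numeral mult_ac)
  also have "\<dots> \<le> 11 * (K ^ 3 / \<delta> ^ 6 * (1 / d)\<^sup>2)"
    using assms by (intro mult_right_mono) auto
  finally show ?thesis by simp
qed

text \<open>One velocity form is taken from each plank. The three factors 2 in the separation
  hypotheses cost 8 against the 6 in the determinant, which leads to the same constant
  \<open>32 / 3\<close>.\<close>

lemma measure_three_planks_le:
  assumes "compact S" "S \<subseteq> standard_plank K \<delta> a" "S \<subseteq> standard_plank K \<delta> b"
    "S \<subseteq> standard_plank K \<delta> c"
    and "0 \<le> K" "0 < \<delta>" "0 < d" "0 < e" "0 < f"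
    and "\<delta> * d \<le> 2 * \<bar>a - b\<bar>" "\<delta> * e \<le> 2 * \<bar>b - c\<bar>" "\<delta> * f \<le> 2 * \<bar>a - c\<bar>"
  shows "measure lborel S \<le> 11 * K ^ 3 / \<delta> ^ 6 * (1 / d) * (1 / e) * (1 / f)"
proof -
  have "(\<delta> * d) * (\<delta> * e) * (\<delta> * f) \<le> (2 * \<bar>a - b\<bar>) * (2 * \<bar>b - c\<bar>) * (2 * \<bar>a - c\<bar>)"
    by (rule mult_mono[OF mult_mono[OF assms(10,11)] assms(12)]) (use assms in auto)
  also have "\<dots> = 8 / 6 * \<bar>6 * (b - a) * (c - b) * (c - a)\<bar>"
    by (simp only: abs_mult abs_minus_commute[of b a] abs_minus_commute[of c b]
        abs_minus_commute[of c a])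
  finally have "3 / 4 * (\<delta> ^ 3 * (d * e * f)) * measure lborel S
      \<le> \<bar>6 * (b - a) * (c - b) * (c - a)\<bar> * measure lborel S"
    by (intro mult_right_mono) (auto simp: eval_nat_numeral mult_ac)
  also have "\<dots> = \<bar>det (vector [curve_velocity a, curve_velocity b, curve_velocity c] :: real^3^3)\<bar>
      * measure lborel S"
    by (simp only: det_velocity_velocity_velocity)
  also have "\<dots> \<le> 8 * (K / \<delta>) * (K / \<delta>) * (K / \<delta>)"
    by (rule det_times_measure_le) (use assms in \<open>auto simp: standard_plank_def\<close>)
  finally have "measure lborel S
      \<le> 8 * (K / \<delta>) * (K / \<delta>) * (K / \<delta>) / (3 / 4 * (\<delta> ^ 3 * (d * e * f)))"
    using assms by (subst pos_le_divide_eq) (auto simp: mult_ac)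
  also have "\<dots> = 32 / 3 * (K ^ 3 / \<delta> ^ 6 * (1 / d) * (1 / e) * (1 / f))"
    by (simp add: eval_nat_numeral mult_ac)
  also have "\<dots> \<le> 11 * (K ^ 3 / \<delta> ^ 6 * (1 / d) * (1 / e) * (1 / f))"
    using assms by (intro mult_right_mono) auto
  finally show ?thesis by simp
qed

text \<open>If two of the indices coincide, their weight is 1 and the other two weights are equal,
  so the product is a square, as in the bound for two planks. If all three coincide, it is 1 and the
  bound for one plank applies.\<close>

lemma measure_plank_triple_le:
  fixes c :: "'i \<Rightarrow> real" and \<kappa> :: "'i \<Rightarrow> nat"
  assumes S: "compact S" "\<And>l. l \<in> {i, j, k} \<Longrightarrow> S \<subseteq> standard_plank K \<delta> (c l)"
    and pos: "0 \<le> K" "0 < \<delta>"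
    and inj: "inj_on \<kappa> {i, j, k}"
    and sep: "\<And>l m. l \<in> {i, j, k} \<Longrightarrow> m \<in> {i, j, k} \<Longrightarrow>
      \<delta> * \<bar>real (\<kappa> l) - real (\<kappa> m)\<bar> \<le> 2 * \<bar>c l - c m\<bar>"
  shows "measure lborel S \<le> 11 * K ^ 3 / \<delta> ^ 6 * sep_weight (\<kappa> i) (\<kappa> j)
    * sep_weight (\<kappa> j) (\<kappa> k) * sep_weight (\<kappa> i) (\<kappa> k)"
proof -
  have two: "measure lborel S \<le> 11 * K ^ 3 / \<delta> ^ 6 * (sep_weight (\<kappa> l) (\<kappa> m))\<^sup>2"
    if "l \<in> {i, j, k}" "m \<in> {i, j, k}" for l m
  proof (cases "l = m")
    case True
    have "measure lborel S \<le> 8 * K ^ 3 / \<delta> ^ 6"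
      using S that pos by (intro measure_one_plank_le) auto
    also have "\<dots> \<le> 11 * K ^ 3 / \<delta> ^ 6"
      using pos by (intro divide_right_mono mult_right_mono) auto
    finally show ?thesis using True by simp
  next
    case False
    then have "\<kappa> l \<noteq> \<kappa> m"
      using inj_on_eq_iff[OF inj that] by simp
    then show ?thesis
      using measure_two_planks_le[OF S(1) S(2)[OF that(1)] S(2)[OF that(2)] pos _ sep[OF that]]
      by (simp add: sep_weight_distinct)
  qed
  consider "i = j" | "j = k" | "i = k" | "i \<noteq> j" "j \<noteq> k" "i \<noteq> k" by blast
  then show ?thesis
  proof cases
    case 1
    then show ?thesis using two[of j k] by (simp add: power2_eq_square mult_ac)
  next
    case 2
    then show ?thesis using two[of i k] by (simp add: power2_eq_square mult_ac)
  next
    case 3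
    then show ?thesis using two[of j k]
      by (simp add: power2_eq_square mult_ac sep_weight_commute[of "\<kappa> k" "\<kappa> j"])
  next
    case 4
    then have ne: "\<kappa> i \<noteq> \<kappa> j" "\<kappa> j \<noteq> \<kappa> k" "\<kappa> i \<noteq> \<kappa> k"
      using inj by (simp_all add: inj_on_eq_iff[OF inj])
    then have "0 < \<bar>real (\<kappa> i) - real (\<kappa> j)\<bar>" "0 < \<bar>real (\<kappa> j) - real (\<kappa> k)\<bar>"
      "0 < \<bar>real (\<kappa> i) - real (\<kappa> k)\<bar>"
      by auto
    from measure_three_planks_le[OF S(1) S(2) S(2) S(2) pos this sep sep sep]
    show ?thesis using ne by (simp add: sep_weight_distinct)
  qed
qed

section \<open>Comparison with the Frenet boxes\<close>

text \<open>Velocity is a multiple of the tangent, half acceleration a combination of normal and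
  velocity, and the third coordinate is at most the norm; so bounds in the frame carry over to the
  three forms.\<close>

lemma standard_plank_contains:
  assumes plank: "vinogradov_plank C I P" and "1 \<le> C"
    and \<delta>: "measure lborel I = \<delta>" "0 < \<delta>" "\<delta> \<le> 1"
    and c: "0 \<le> Inf I" "Inf I \<le> 1"
  shows "P \<subseteq> standard_plank (36 * C) \<delta> (Inf I)"
proof
  fix x assume "x \<in> P"
  then obtain y where y: "y \<in> frenet_box I" and x: "x = C *\<^sub>R y"
    using plank by (auto simp: vinogradov_plank_def)
  let ?c = "Inf I"
  define p where "p = C / (2 * \<delta>)"
  define q where "q = C / (2 * \<delta>\<^sup>2)"
  define r where "r = C / (2 * \<delta> ^ 3)"
  have pw: "\<delta> ^ 2 \<le> \<delta>" "\<delta> ^ 3 \<le> \<delta>\<^sup>2"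
    using \<delta> by (auto simp: eval_nat_numeral mult_le_one mult_left_le)
  \<comment> \<open>Since \<open>\<delta> \<le> 1\<close>, the half sides increase, and
    contributions of shorter directions are absorbed by longer ones.\<close>
  have le: "0 \<le> p" "p \<le> q" "q \<le> r"
    using \<delta> pw \<open>1 \<le> C\<close> unfolding p_def q_def r_def by (auto intro!: divide_left_mono)
  have t: "\<bar>x \<bullet> frenet_tangent ?c\<bar> \<le> p" and n: "\<bar>x \<bullet> frenet_normal ?c\<bar> \<le> q"
    and b: "\<bar>x \<bullet> frenet_binormal ?c\<bar> \<le> r"
    using y \<open>1 \<le> C\<close> \<delta>
    by (auto simp: frenet_box_def x abs_mult p_def q_def r_def power_divide
        dest: mult_left_mono[of _ _ C])
  note bounds = moment_curve_bounds[OF c]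
  have v: "\<bar>x \<bullet> curve_velocity ?c\<bar> \<le> 4 * p"
    unfolding inner_eq_norm_times_inner_sgn[of x "curve_velocity ?c"] abs_mult abs_norm_cancel
      frenet_tangent_eq[symmetric]
    using bounds(1) t by (intro mult_mono) auto
  have w: "\<bar>x \<bullet> curve_normal ?c\<bar> \<le> 28 * q"
    unfolding inner_eq_norm_times_inner_sgn[of x "curve_normal ?c"] abs_mult abs_norm_cancel
      frenet_normal_eq[symmetric]
    using bounds(2) n by (intro mult_mono) auto
  \<comment> \<open>The squared speed is at least 1, so multiplying by it is harmless and makes the
    Gram-Schmidt identity applicable. The total is \<open>28 + 11 * 4 = 72\<close>; the halves in
    \<open>p\<close>, \<open>q\<close>, \<open>r\<close> turn this into 36.\<close>
  have "\<bar>x \<bullet> curve_half_acceleration ?c\<bar> \<le> curve_speed_sq ?c * \<bar>x \<bullet> curve_half_acceleration ?c\<bar>"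
    using mult_right_mono[OF curve_speed_sq_ge_1[of ?c], of "\<bar>x \<bullet> curve_half_acceleration ?c\<bar>"]
    by simp
  also have "\<dots> = \<bar>x \<bullet> (curve_speed_sq ?c *\<^sub>R curve_half_acceleration ?c)\<bar>"
    using curve_speed_sq_ge_1[of ?c] by (simp add: abs_mult)
  also have "\<dots> = \<bar>x \<bullet> curve_normal ?c + (2 * ?c + 9 * ?c ^ 3) * (x \<bullet> curve_velocity ?c)\<bar>"
    by (simp add: half_acceleration_decomposition inner_add_right)
  also have "\<dots> \<le> \<bar>x \<bullet> curve_normal ?c\<bar> + (2 * ?c + 9 * ?c ^ 3) * \<bar>x \<bullet> curve_velocity ?c\<bar>"
    using c by (intro order_trans[OF abs_triangle_ineq]) (simp add: abs_mult)
  also have "\<dots> \<le> 28 * q + 11 * (4 * p)"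
    using w v bounds(3) le by (intro add_mono mult_mono) auto
  finally have a: "\<bar>x \<bullet> curve_half_acceleration ?c\<bar> \<le> 72 * q"
    using le by linarith
  have "\<bar>x \<bullet> axis 3 1\<bar> \<le> norm x"
    using component_le_norm_cart[of x 3] by (simp add: inner_axis)
  also have "\<dots> \<le> 3 * r"
    using norm_le_orthonormal_sum[OF frenet_frame_orthonormal, of x ?c] t n b le by linarith
  finally have e: "\<bar>x \<bullet> axis 3 1\<bar> \<le> 72 * r"
    using le by linarith
  show "x \<in> standard_plank (36 * C) \<delta> ?c"
    using v a e le by (simp add: standard_plank_def p_def q_def r_def)
qed

lemma compact_vinogradov_plank: "compact P" if "vinogradov_plank C I P"
  using that
  by (auto simp: vinogradov_plank_def centred_box_def linear_conv_bounded_linear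
      intro!: compact_continuous_image linear_continuous_on)

text \<open>The plank contains the Frenet box shrunk by \<open>C\<close>, an orthonormal box with
  side lengths \<open>1 / (C * \<delta>)\<close>, \<open>1 / (C * \<delta>^2)\<close>,
  \<open>1 / (C * \<delta>^3)\<close>.\<close>

lemma measure_vinogradov_plank_ge:
  assumes plank: "vinogradov_plank C I P" and "1 \<le> C"
    and \<delta>: "measure lborel I = \<delta>" "0 < \<delta>"
  shows "1 / (C ^ 3 * \<delta> ^ 6) \<le> measure lborel P"
proof -
  let ?c = "Inf I"
  let ?B = "{x. \<bar>x \<bullet> frenet_tangent ?c\<bar> \<le> 1 / (2 * C * \<delta>) \<and>
      \<bar>x \<bullet> frenet_normal ?c\<bar> \<le> 1 / (2 * C * \<delta>\<^sup>2) \<and>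
      \<bar>x \<bullet> frenet_binormal ?c\<bar> \<le> 1 / (2 * C * \<delta> ^ 3)}"
  have nn: "0 \<le> 1 / (2 * C * \<delta>)" "0 \<le> 1 / (2 * C * \<delta>\<^sup>2)" "0 \<le> 1 / (2 * C * \<delta> ^ 3)"
    using \<delta> \<open>1 \<le> C\<close> by auto
  note box = measure_orthonormal_box[OF frenet_frame_orthonormal nn]
  have "?B \<subseteq> P"
  proof
    fix x assume x: "x \<in> ?B"
    then have "C *\<^sub>R x \<in> frenet_box I"
      using \<delta> \<open>1 \<le> C\<close> by (auto simp: frenet_box_def abs_mult power_divide field_simps)
    then have "(1 / C) *\<^sub>R (C *\<^sub>R x) \<in> P"
      using plank unfolding vinogradov_plank_def by blast
    then show "x \<in> P" using \<open>1 \<le> C\<close> by simp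
  qed
  have "1 / (C ^ 3 * \<delta> ^ 6) = measure lebesgue ?B"
    unfolding box(1) by (simp add: eval_nat_numeral mult_ac)
  also have "\<dots> \<le> measure lebesgue P"
    using \<open>?B \<subseteq> P\<close> box(2) compact_vinogradov_plank[OF plank]
    by (intro measure_mono_fmeasurable) (auto intro: lmeasurable_compact fmeasurableD)
  also have "\<dots> = measure lborel P"
    using compact_vinogradov_plank[OF plank] by (simp add: borel_compact)
  finally show ?thesis .
qed

subsection \<open>The fourth moment\<close>

lemma integrable_indicator_compact:
  fixes T :: "'a::euclidean_space set"
  assumes "compact T"
  shows "integrable lborel (indicator T :: 'a \<Rightarrow> real)"
  using borel_integrable_compact[OF assms, of "\<lambda>_. 1 :: real"] by simp

text \<open>At each point the integrand is the fourth power of the number of planks through it. The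
  combinatorial bound is applied to that set of planks, and indicators extend its sums to all of
  \<open>A\<close>.\<close>

lemma integral_sum_indicator_powr4_le:
  fixes P :: "'i \<Rightarrow> 'a::euclidean_space set" and \<kappa> :: "'i \<Rightarrow> nat"
  assumes "finite A" "inj_on \<kappa> A" and comp: "\<And>i. i \<in> A \<Longrightarrow> compact (P i)"
  shows "(LINT x|lborel. \<bar>\<Sum>i\<in>A. indicator (P i) x\<bar> powr 4)
    \<le> 3 * (\<Sum>i\<in>A. \<Sum>j\<in>A. \<Sum>k\<in>A. (\<bar>real (\<kappa> i) - real (\<kappa> j)\<bar> + 1)
        * measure lborel (P i \<inter> P j \<inter> P k))"
proof -
  let ?d = "\<lambda>i j. \<bar>real (\<kappa> i) - real (\<kappa> j)\<bar> + 1"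
  let ?G = "\<lambda>x. 3 * (\<Sum>i\<in>A. \<Sum>j\<in>A. \<Sum>k\<in>A. ?d i j * indicator (P i \<inter> P j \<inter> P k) x)"
  have int: "integrable lborel (indicator (P i \<inter> P j \<inter> P k) :: 'a \<Rightarrow> real)"
    if "i \<in> A" "j \<in> A" "k \<in> A" for i j k
    using that comp by (intro integrable_indicator_compact compact_Int)
  have "(LINT x|lborel. \<bar>\<Sum>i\<in>A. indicator (P i) x\<bar> powr 4) \<le> (LINT x|lborel. ?G x)"
  proof (rule Bochner_Integration.integral_mono')
    show "integrable lborel ?G"
      by (intro integrable_mult_right Bochner_Integration.integrable_sum int)
  next
    fix x
    let ?S = "{i \<in> A. x \<in> P i}"
    have "(\<Sum>i\<in>A. indicator (P i) x) = real (card ?S)"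
      using \<open>finite A\<close> by (simp add: indicator_def of_bool_def sum.If_cases Int_def)
    then have "\<bar>\<Sum>i\<in>A. indicator (P i) x :: real\<bar> powr 4 = real (card ?S) ^ 4"
      by (cases "card ?S = 0") (simp_all flip: powr_numeral)
    also have "\<dots> \<le> 3 * (\<Sum>i\<in>?S. \<Sum>j\<in>?S. \<Sum>k\<in>?S. ?d i j)"
      using assms by (intro card_power4_le_sum_dist) (auto intro: inj_on_subset)
    also have "(\<Sum>i\<in>?S. \<Sum>j\<in>?S. \<Sum>k\<in>?S. ?d i j)
        = (\<Sum>i\<in>A. \<Sum>j\<in>A. \<Sum>k\<in>A. ?d i j * indicator (P i \<inter> P j \<inter> P k) x)"
    proof -
      have "(\<Sum>i\<in>?S. g i) = (\<Sum>i\<in>A. g i * indicator (P i) x)" for g :: "'i \<Rightarrow> real"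
        using \<open>finite A\<close> by (intro sum.mono_neutral_cong_left) (auto simp: indicator_def)
      then show ?thesis
        by (simp only: indicator_inter_arith sum_distrib_left mult_ac)
    qed
    finally show "\<bar>\<Sum>i\<in>A. indicator (P i) x :: real\<bar> powr 4 \<le> ?G x" .
  qed (auto intro!: sum_nonneg)
  also have "\<dots> = 3 * (\<Sum>i\<in>A. \<Sum>j\<in>A. \<Sum>k\<in>A. ?d i j * (LINT x|lborel. indicator (P i \<inter> P j \<inter> P k) x))"
    by (simp add: Bochner_Integration.integral_sum int)
  finally show ?thesis by simp
qed

lemma Lp_norm_one_sum_indicator:
  fixes P :: "'i \<Rightarrow> 'a::euclidean_space set"
  assumes "finite A" and comp: "\<And>i. i \<in> A \<Longrightarrow> compact (P i)"
  shows "Lp_norm 1 (\<lambda>x. \<Sum>i\<in>A. indicator (P i) x) = (\<Sum>i\<in>A. measure lborel (P i))"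
proof -
  have int: "integrable lborel (indicator (P i) :: 'a \<Rightarrow> real)" if "i \<in> A" for i
    using that comp by (intro integrable_indicator_compact)
  have "(LINT x|lborel. \<bar>\<Sum>i\<in>A. indicator (P i) x :: real\<bar> powr 1)
      = (LINT x|lborel. (\<Sum>i\<in>A. indicator (P i) x))"
    by (intro Bochner_Integration.integral_cong) (auto simp: sum_nonneg)
  also have "\<dots> = (\<Sum>i\<in>A. measure lborel (P i))"
    by (simp add: Bochner_Integration.integral_sum int)
  finally show ?thesis
    by (simp add: Lp_norm_def sum_nonneg)
qed

lemma Lp_norm_four_power4: "Lp_norm 4 f ^ 4 = (LINT x|lborel. \<bar>f x\<bar> powr 4)"
proof -
  have "0 \<le> (LINT x|lborel. \<bar>f x\<bar> powr 4)" by simp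
  then show ?thesis
    unfolding Lp_norm_def
    by (cases "(LINT x|lborel. \<bar>f x\<bar> powr 4) = 0") (simp_all add: powr_powr flip: powr_numeral)
qed

text \<open>After the weight of \<open>i\<close> and \<open>j\<close> is cancelled, these indices
  interact only through \<open>k\<close>; with \<open>k\<close> outermost the inner double sum
  factors into a square.\<close>

lemma sum_triple_sep_weight_le:
  fixes \<kappa> :: "'i \<Rightarrow> nat"
  assumes "finite A" "inj_on \<kappa> A" "\<And>i. i \<in> A \<Longrightarrow> \<kappa> i \<le> N"
  shows "(\<Sum>i\<in>A. \<Sum>j\<in>A. \<Sum>k\<in>A. (\<bar>real (\<kappa> i) - real (\<kappa> j)\<bar> + 1) * (sep_weight (\<kappa> i) (\<kappa> j)
      * sep_weight (\<kappa> j) (\<kappa> k) * sep_weight (\<kappa> i) (\<kappa> k)))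
    \<le> 2 * real (card A) * (1 + 2 * harm N)\<^sup>2" (is "?L \<le> _")
proof -
  have one: "(\<Sum>i\<in>A. sep_weight (\<kappa> i) (\<kappa> k)) \<le> 1 + 2 * harm N" if "k \<in> A" for k
  proof -
    \<comment> \<open>Injectivity makes this a sum over distinct integers, each at most
      \<open>N\<close>.\<close>
    have "(\<Sum>i\<in>A. sep_weight (\<kappa> i) (\<kappa> k)) = (\<Sum>m\<in>\<kappa> ` A. sep_weight m (\<kappa> k))"
      using assms(2) by (simp add: sum.reindex)
    also have "\<dots> \<le> (\<Sum>m\<le>N. sep_weight m (\<kappa> k))"
      using assms by (intro sum_mono2) auto
    also have "\<dots> \<le> 1 + 2 * harm N"
      using assms(3)[OF that] by (rule sum_sep_weight_le)
    finally show ?thesis .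
  qed
  have "?L \<le> (\<Sum>i\<in>A. \<Sum>j\<in>A. \<Sum>k\<in>A. 2 * (sep_weight (\<kappa> j) (\<kappa> k) * sep_weight (\<kappa> i) (\<kappa> k)))"
  proof (intro sum_mono)
    fix i j k
    show "(\<bar>real (\<kappa> i) - real (\<kappa> j)\<bar> + 1) * (sep_weight (\<kappa> i) (\<kappa> j)
      * sep_weight (\<kappa> j) (\<kappa> k) * sep_weight (\<kappa> i) (\<kappa> k))
      \<le> 2 * (sep_weight (\<kappa> j) (\<kappa> k) * sep_weight (\<kappa> i) (\<kappa> k))"
      using mult_right_mono[OF dist_times_sep_weight_le[of "\<kappa> i" "\<kappa> j"],
          of "sep_weight (\<kappa> j) (\<kappa> k) * sep_weight (\<kappa> i) (\<kappa> k)"]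
      by (simp add: mult_ac)
  qed
  also have "\<dots> = (\<Sum>i\<in>A. \<Sum>k\<in>A. \<Sum>j\<in>A. 2 * (sep_weight (\<kappa> j) (\<kappa> k) * sep_weight (\<kappa> i) (\<kappa> k)))"
    by (rule sum.cong[OF refl], rule sum.swap)
  also have "\<dots> = (\<Sum>k\<in>A. \<Sum>i\<in>A. \<Sum>j\<in>A. 2 * (sep_weight (\<kappa> j) (\<kappa> k) * sep_weight (\<kappa> i) (\<kappa> k)))"
    by (rule sum.swap)
  also have "\<dots> = (\<Sum>k\<in>A. 2 * (\<Sum>i\<in>A. sep_weight (\<kappa> i) (\<kappa> k))\<^sup>2)"
    by (simp add: power2_eq_square sum_product sum_distrib_left mult_ac)
  also have "\<dots> \<le> (\<Sum>k\<in>A. 2 * (1 + 2 * harm N)\<^sup>2)"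
    by (intro sum_mono mult_left_mono power_mono one sum_nonneg) auto
  finally show ?thesis by simp
qed

subsection \<open>Partitions into intervals of equal length\<close>

text \<open>Length is additive over a division; in particular \<open>1 / \<delta>\<close> is an
  integer.\<close>

lemma equal_division_card:
  assumes "II division_of {0..1::real}" "\<forall>I\<in>II. measure lborel I = \<delta>"
  shows "real (card II) * \<delta> = 1"
proof -
  have "sum (measure lborel) II = 1"
    using additive_content_division[of II 0 "1::real"] assms(1) by simp
  then show ?thesis
    using assms(2) by simp
qed

lemma equal_division_interval:
  assumes "II division_of {0..1::real}" "I \<in> II" "measure lborel I = \<delta>" "0 < \<delta>"
  shows "I = {Inf I..Inf I + \<delta>}" "0 \<le> Inf I" "Inf I \<le> 1"
proof -
  obtain a b where I: "I = {a..b}"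
    using division_ofD(4)[OF assms(1,2)] by auto
  moreover have "a \<le> b"
    using division_ofD(3)[OF assms(1,2)] I by auto
  ultimately show "I = {Inf I..Inf I + \<delta>}" "0 \<le> Inf I" "Inf I \<le> 1"
    using assms(3) division_ofD(2)[OF assms(1,2)] by auto
qed

lemma equal_division_separated:
  assumes "II division_of {0..1::real}" "\<forall>I\<in>II. measure lborel I = \<delta>" "0 < \<delta>"
    and "I \<in> II" "J \<in> II" "I \<noteq> J"
  shows "\<delta> \<le> \<bar>Inf I - Inf J\<bar>"
proof (rule ccontr)
  assume close: "\<not> ?thesis"
  have eq: "I = {Inf I..Inf I + \<delta>}" "J = {Inf J..Inf J + \<delta>}"
    using assms equal_division_interval(1) by blast+
  have "interior I = {Inf I<..<Inf I + \<delta>}" "interior J = {Inf J<..<Inf J + \<delta>}"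
    by (subst eq, rule interior_atLeastAtMost_real)+
  \<comment> \<open>The witness is the midpoint of the overlap, which runs from the larger left end
    to the smaller right end.\<close>
  moreover have "max (Inf I) (Inf J) / 2 + min (Inf I) (Inf J) / 2 + \<delta> / 2
      \<in> {Inf I<..<Inf I + \<delta>} \<inter> {Inf J<..<Inf J + \<delta>}"
    using close by (auto simp: max_def min_def abs_if field_simps split: if_splits)
  ultimately show False
    using division_ofD(5)[OF assms(1,4,5,6)] by blast
qed

section \<open>The fourth moment estimate for equal divisions\<close>

theorem theorem5p1:
  fixes C :: real
  assumes "C \<ge> 1"
  shows "\<exists>K::real. \<forall>(\<delta>::real) (II :: real set set) (P :: real set \<Rightarrow> (real^3) set).
    0 < \<delta> \<longrightarrow> \<delta> < 1 \<longrightarrow>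
    II division_of {0..1} \<longrightarrow> (\<forall>I\<in>II. measure lborel I = \<delta>) \<longrightarrow>
    (\<forall>I\<in>II. vinogradov_plank C I (P I)) \<longrightarrow>
    (Lp_norm 4 (\<lambda>x. \<Sum>I\<in>II. indicator (P I) x)) ^ 4
      \<le> K * (ln (1 / \<delta>))\<^sup>2 * Lp_norm 1 (\<lambda>x. \<Sum>I\<in>II. indicator (P I) x)"
proof -
  define A where "A = 11 * (36 * C) ^ 3"
  have "A \<ge> 0"
    using assms by (simp add: A_def)
  show ?thesis
  \<comment> \<open>\<open>384 = 3 * 2 * 8^2\<close>: 3 from the combinatorial bound, 2 from the
    cancellation of weights, 8 from the logarithm. \<open>A\<close> comes from the triple
    intersections and \<open>C ^ 3\<close> from the lower volume bound.\<close>
  proof (intro exI[of _ "384 * A * C ^ 3"] allI impI)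
    fix \<delta> :: real and II :: "real set set" and P :: "real set \<Rightarrow> (real^3) set"
    assume \<delta>: "0 < \<delta>" "\<delta> < 1" and div: "II division_of {0..1}"
      and len: "\<forall>I\<in>II. measure lborel I = \<delta>"
      and planks: "\<forall>I\<in>II. vinogradov_plank C I (P I)"
    define N where "N = card II"
    define \<kappa> where "\<kappa> I = nat \<lfloor>Inf I / \<delta>\<rfloor>" for I
    have fin: "finite II" using div by blast
    have comp: "compact (P I)" if "I \<in> II" for I
      using planks that compact_vinogradov_plank by blast
    have N: "real N = 1 / \<delta>"
      using equal_division_card[OF div len] \<delta> by (simp add: N_def field_simps)
    then have "real N > 1"
      using \<delta> by simp
    \<comment> \<open>As \<open>1 / \<delta>\<close> is an integer, it cannot approach 1; this keeps
      \<open>ln (1 / \<delta>)\<close> away from 0.\<close>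
    then have "N \<ge> 2" by simp
    have Inf: "0 \<le> Inf I" "Inf I \<le> 1" if "I \<in> II" for I
      using equal_division_interval[OF div that] len that \<delta> by auto
    have \<kappa>: "real (\<kappa> I) = of_int \<lfloor>Inf I / \<delta>\<rfloor>" if "I \<in> II" for I
      using Inf[OF that] \<delta> by (simp add: \<kappa>_def)
    have \<kappa>_near: "real (\<kappa> I) \<le> Inf I / \<delta>" "Inf I / \<delta> < real (\<kappa> I) + 1" if "I \<in> II" for I
      unfolding \<kappa>[OF that] by linarith+
    have \<kappa>_le: "\<kappa> I \<le> N" if "I \<in> II" for I
    proof -
      have "Inf I / \<delta> \<le> 1 / \<delta>"
        using Inf[OF that] \<delta> by (intro divide_right_mono) auto
      then show ?thesis
        using \<kappa>_near[OF that] N by linarith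
    qed
    have far: "1 \<le> \<bar>Inf I / \<delta> - Inf J / \<delta>\<bar>" if "I \<in> II" "J \<in> II" "I \<noteq> J" for I J
    proof -
      have "\<bar>Inf I / \<delta> - Inf J / \<delta>\<bar> = \<bar>Inf I - Inf J\<bar> / \<delta>"
        using \<delta> by (simp flip: diff_divide_distrib)
      then show ?thesis
        using equal_division_separated[OF div len \<delta>(1) that] \<delta> by simp
    qed
    \<comment> \<open>Equal floors would put the rescaled left ends at distance less than 1.\<close>
    have inj: "inj_on \<kappa> II"
    proof (rule inj_onI, rule ccontr)
      fix I J assume IJ: "I \<in> II" "J \<in> II" "\<kappa> I = \<kappa> J" "I \<noteq> J"
      show False
        using far[OF IJ(1,2,4)] \<kappa>_near[OF IJ(1)] \<kappa>_near[OF IJ(2)] IJ(3) by linarith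
    qed
    \<comment> \<open>Rounding adds at most 1 to a distance that is already at least 1, hence the
      factor 2.\<close>
    have sep: "\<delta> * \<bar>real (\<kappa> I) - real (\<kappa> J)\<bar> \<le> 2 * \<bar>Inf I - Inf J\<bar>"
      if "I \<in> II" "J \<in> II" for I J
    proof (cases "I = J")
      case False
      have "\<bar>real (\<kappa> I) - real (\<kappa> J)\<bar> \<le> \<bar>Inf I / \<delta> - Inf J / \<delta>\<bar> + 1"
        using \<kappa>_near[OF that(1)] \<kappa>_near[OF that(2)] by linarith
      also have "\<dots> \<le> 2 * \<bar>Inf I / \<delta> - Inf J / \<delta>\<bar>"
        using far[OF that False] by simp
      also have "\<dots> = 2 * \<bar>Inf I - Inf J\<bar> / \<delta>"
        using \<delta> by (simp flip: diff_divide_distrib)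
      finally show ?thesis
        using \<delta> by (simp add: field_simps)
    qed simp
    have sub: "P I \<subseteq> standard_plank (36 * C) \<delta> (Inf I)" if "I \<in> II" for I
      using standard_plank_contains[of C I "P I" \<delta>] planks that assms len \<delta> Inf[OF that] by auto
    have triple: "measure lborel (P I \<inter> P J \<inter> P L) \<le> A / \<delta> ^ 6 * (sep_weight (\<kappa> I) (\<kappa> J)
        * sep_weight (\<kappa> J) (\<kappa> L) * sep_weight (\<kappa> I) (\<kappa> L))"
      if "I \<in> II" "J \<in> II" "L \<in> II" for I J L
    proof -
      have "compact (P I \<inter> P J \<inter> P L)"
        using comp that by (intro compact_Int) auto
      moreover have "P I \<inter> P J \<inter> P L \<subseteq> standard_plank (36 * C) \<delta> (Inf M)"
        if "M \<in> {I, J, L}" for M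
        using that sub \<open>I \<in> II\<close> \<open>J \<in> II\<close> \<open>L \<in> II\<close> by blast
      moreover have "inj_on \<kappa> {I, J, L}"
        by (rule inj_on_subset[OF inj]) (use that in auto)
      ultimately have "measure lborel (P I \<inter> P J \<inter> P L) \<le> 11 * (36 * C) ^ 3 / \<delta> ^ 6
          * sep_weight (\<kappa> I) (\<kappa> J) * sep_weight (\<kappa> J) (\<kappa> L) * sep_weight (\<kappa> I) (\<kappa> L)"
        using assms \<delta> that by (intro measure_plank_triple_le[where c = Inf] sep) auto
      then show ?thesis
        by (simp add: A_def mult.assoc)
    qed
    \<comment> \<open>The left side is at most \<open>3 + 2 * ln N\<close>, and
      \<open>ln N \<ge> 1 / 2\<close> gives \<open>3 \<le> 6 * ln N\<close>.\<close>
    have log: "1 + 2 * harm N \<le> 8 * ln (1 / \<delta>)"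
    proof -
      have "1 / 2 \<le> ln (2::real)"
        using ln2_ge_two_thirds by simp
      also have "\<dots> \<le> ln (real N)"
        using \<open>N \<ge> 2\<close> by simp
      finally show ?thesis
        using harm_le_ln[of N] \<open>N \<ge> 2\<close> by (simp flip: N)
    qed
    let ?F = "\<lambda>x. \<Sum>I\<in>II. indicator (P I) x :: real"
    have "Lp_norm 4 ?F ^ 4 \<le> 3 * (\<Sum>I\<in>II. \<Sum>J\<in>II. \<Sum>L\<in>II.
        (\<bar>real (\<kappa> I) - real (\<kappa> J)\<bar> + 1) * measure lborel (P I \<inter> P J \<inter> P L))"
      unfolding Lp_norm_four_power4 by (rule integral_sum_indicator_powr4_le[OF fin inj comp])
    also have "\<dots> \<le> 3 * (\<Sum>I\<in>II. \<Sum>J\<in>II. \<Sum>L\<in>II. (\<bar>real (\<kappa> I) - real (\<kappa> J)\<bar> + 1)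
        * (A / \<delta> ^ 6 * (sep_weight (\<kappa> I) (\<kappa> J) * sep_weight (\<kappa> J) (\<kappa> L) * sep_weight (\<kappa> I) (\<kappa> L))))"
      by (intro mult_left_mono sum_mono triple) auto
    also have "\<dots> = 3 * (A / \<delta> ^ 6) * (\<Sum>I\<in>II. \<Sum>J\<in>II. \<Sum>L\<in>II. (\<bar>real (\<kappa> I) - real (\<kappa> J)\<bar> + 1)
        * (sep_weight (\<kappa> I) (\<kappa> J) * sep_weight (\<kappa> J) (\<kappa> L) * sep_weight (\<kappa> I) (\<kappa> L)))"
      by (simp only: sum_distrib_left mult_ac)
    also have "\<dots> \<le> 3 * (A / \<delta> ^ 6) * (2 * real N * (1 + 2 * harm N)\<^sup>2)"
      unfolding N_def[symmetric]
      using sum_triple_sep_weight_le[OF fin inj \<kappa>_le] \<open>A \<ge> 0\<close> \<delta>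
      by (intro mult_left_mono) (auto simp: N_def)
    also have "\<dots> \<le> 3 * (A / \<delta> ^ 6) * (2 * real N * (8 * ln (1 / \<delta>))\<^sup>2)"
      using log \<open>A \<ge> 0\<close> \<delta> by (intro mult_left_mono power_mono) (auto simp: harm_nonneg)
    \<comment> \<open>The factor \<open>C ^ 3\<close> is inserted and divided out again so that the
      last factor is \<open>N\<close> times the lower bound for the volume of a plank, which the L1
      norm dominates.\<close>
    also have "\<dots> = 384 * A * C ^ 3 * (ln (1 / \<delta>))\<^sup>2 * (real N * (1 / (C ^ 3 * \<delta> ^ 6)))"
      using assms by (simp add: power_mult_distrib)
    also have "\<dots> \<le> 384 * A * C ^ 3 * (ln (1 / \<delta>))\<^sup>2 * Lp_norm 1 ?F"
    proof (rule mult_left_mono)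
      have "real N * (1 / (C ^ 3 * \<delta> ^ 6)) = (\<Sum>I\<in>II. 1 / (C ^ 3 * \<delta> ^ 6))"
        by (simp add: N_def)
      also have "\<dots> \<le> (\<Sum>I\<in>II. measure lborel (P I))"
        using planks len \<delta> assms by (intro sum_mono measure_vinogradov_plank_ge) auto
      finally show "real N * (1 / (C ^ 3 * \<delta> ^ 6)) \<le> Lp_norm 1 ?F"
        by (simp only: Lp_norm_one_sum_indicator[OF fin comp])
      show "0 \<le> 384 * A * C ^ 3 * (ln (1 / \<delta>))\<^sup>2"
        using \<open>A \<ge> 0\<close> assms by simp
    qed
    finally show "Lp_norm 4 ?F ^ 4 \<le> 384 * A * C ^ 3 * (ln (1 / \<delta>))\<^sup>2 * Lp_norm 1 ?F" .
  qed
qed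

end
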